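(* For every open set $\Omega\subset\mathbb{R}^n$ and every $k\in\mathbb{N}$ (i.e. $k\ge1$), $$S^{k+1}(\Omega)\subset C^k(\Omega)\subset S^k(\Omega),$$ where $S^k(\Omega)$ is the specular space of order $k$ and $C^k(\Omega)$ is the usual space of real-valued functions on $\Omega$ with continuous partial derivatives up to order $k$.
   Context: Let $\Omega\subset\mathbb{R}^n$ be open, $u:\Omega\to\mathbb{R}$, and let $e_i$ be the $i$-th standard basis vector. One-sided limits: $u[x)_{(i)}:=\lim_{h\searrow0}u(x+he_i)$, $u(x]_{(i)}:=\lim_{h\nearrow0}u(x+he_i)$. Specular partial derivatives: $$\partial^R_{x_i}u(x)=\lim_{h\searrow0}\frac{u(x+he_i)-u[x)_{(i)}}{h},\qquad \partial^L_{x_i}u(x)=\lim_{h\nearrow0}\frac{u(x+he_i)-u(x]_{(i)}}{h}$$ (as real numbers). The specular partial derivative $\partial^S_{x_i}u(x)$ exists if both limits exist and $u[x)_{(i)}=u(x]_{(i)}$. With $\alpha=\partial^R_{x_i}u(x)$, $\beta=\partial^L_{x_i}u(x)$, it equals $A(\alpha,\beta)$ if $\alpha+\beta\ne0$ and $0$ if $\alpha+\beta=0$, where $$A(\alpha,\beta)=\frac{\alpha\beta-1+\sqrt{(\alpha^2+1)(\beta^2+1)}}{\alpha+\beta}.$$ For a multi-index $\alpha=(\alpha_1,\dots,\alpha_n)$, $(\partial^S)^\alpha u=(\partial^S_{x_1})^{\alpha_1}\cdots(\partial^S_{x_n})^{\alpha_n}u$, with $(\partial^S_{x_i})^0u=u$,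 and $|\alpha|=\alpha_1+\dots+\alpha_n$. Also $\partial^S_{x_ix_j}u:=\partial^S_{x_j}\partial^S_{x_i}u$. Singular hyperplanes: an affine hyperplane $\hbar$ in a set $X\subset\mathbb{R}^n$ is given by an equation $a\cdot x=b$, $x\in X$ ($a\in\mathbb{R}^n\setminus\{0\}$, $b\in\mathbb{R}$), with graph $\mathcal{G}(\hbar)=\{x\in X:a\cdot x=b\}$. If $\hbar$ is such a hyperplane in a connected subset of $\Omega$ and there is a variable $x_i$ such that $u(x]_{(i)}\ne u[x)_{(i)}$ for all $x\in\mathcal{G}(\hbar)$, then $\hbar$ is a singular hyperplane of $u$ in $\Omega$. Piecewise continuity: $u$ is ($n$-dimensional) piecewise continuous if there are $m\ge0$ singular hyperplanes $\hbar_1,\dots,\hbar_m$ of $u$ in $\Omega$ such that (i) $u$ is continuous in $\Omega\setminus\bigcup_{\ell}\mathcal{G}(\hbar_\ell)$; (ii) for each $\ell$, the restriction of $u$ to $\mathcal{G}(\hbar_\ell)$ is continuous on $\mathcal{G}(\hbar_\ell)\setminus\bigcup_{j\ne\ell}\mathcal{G}(\hbar_j)$. Proper functions: $u$ is proper, written $u\in S^0(\Omega)$, if $u$ is piecewise continuous in $\Omega$ and for every $a\in\Omega$ and every $1\le i\le n$, $u(a)=A(u(a]_{(i)},u[a)_{(i)})$ if $u(a]_{(i)}+u[a)_{(i)}\ne0$, and $u(a)=0$ if $u(a]_{(i)}+u[a)_{(i)}=0$. Specular space: for $k\ge1$, $S^k(\Omega)$ is the set of all continuous $u:\Omega\to\mathbb{R}$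 such that (i) if $|\alpha|\le k$, then $(\partial^S)^\alpha u$ exists and is in $S^0(\Omega)$; (ii) if $|\alpha|\le k-2$, then $\partial^S_{x_ix_j}(\partial^S)^\alpha u$ is continuous in $\Omega$ whenever $i\ne j$. *)

theory Defs
  imports "HOL-Analysis.Analysis"
begin

text \<open>
  Functions on an open set \<open>\<Omega>\<close> are total functions whose values outside \<open>\<Omega>\<close> are irrelevant:
  everything below is only evaluated at points of \<open>\<Omega>\<close> and is local.  \<open>Lim\<close> and \<open>deriv\<close> yield
  unspecified values where a limit does not exist, so existence is always required separately.
\<close>

definition has_right_lim :: "'n \<Rightarrow> (real^'n \<Rightarrow> real) \<Rightarrow> real^'n \<Rightarrow> bool" where
  "has_right_lim i u x \<longleftrightarrow> (\<exists>l. ((\<lambda>h. u (x + h *\<^sub>R axis i 1)) \<longlongrightarrow> l) (at_right 0))"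

definition right_lim :: "'n \<Rightarrow> (real^'n \<Rightarrow> real) \<Rightarrow> real^'n \<Rightarrow> real" where
  "right_lim i u x = Lim (at_right 0) (\<lambda>h. u (x + h *\<^sub>R axis i 1))"

definition has_left_lim :: "'n \<Rightarrow> (real^'n \<Rightarrow> real) \<Rightarrow> real^'n \<Rightarrow> bool" where
  "has_left_lim i u x \<longleftrightarrow> (\<exists>l. ((\<lambda>h. u (x + h *\<^sub>R axis i 1)) \<longlongrightarrow> l) (at_left 0))"

definition left_lim :: "'n \<Rightarrow> (real^'n \<Rightarrow> real) \<Rightarrow> real^'n \<Rightarrow> real" where
  "left_lim i u x = Lim (at_left 0) (\<lambda>h. u (x + h *\<^sub>R axis i 1))"

subsection \<open>Specular partial derivatives\<close>

text \<open>The difference quotients use the one-sided limits of \<open>u\<close> at \<open>x\<close>, not the value \<open>u x\<close>.\<close>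

definition has_right_partial :: "'n \<Rightarrow> (real^'n \<Rightarrow> real) \<Rightarrow> real^'n \<Rightarrow> bool" where
  "has_right_partial i u x \<longleftrightarrow> has_right_lim i u x \<and>
     (\<exists>d. ((\<lambda>h. (u (x + h *\<^sub>R axis i 1) - right_lim i u x) / h) \<longlongrightarrow> d) (at_right 0))"

definition right_partial :: "'n \<Rightarrow> (real^'n \<Rightarrow> real) \<Rightarrow> real^'n \<Rightarrow> real" where
  "right_partial i u x =
     Lim (at_right 0) (\<lambda>h. (u (x + h *\<^sub>R axis i 1) - right_lim i u x) / h)"

definition has_left_partial :: "'n \<Rightarrow> (real^'n \<Rightarrow> real) \<Rightarrow> real^'n \<Rightarrow> bool" where
  "has_left_partial i u x \<longleftrightarrow> has_left_lim i u x \<and>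
     (\<exists>d. ((\<lambda>h. (u (x + h *\<^sub>R axis i 1) - left_lim i u x) / h) \<longlongrightarrow> d) (at_left 0))"

definition left_partial :: "'n \<Rightarrow> (real^'n \<Rightarrow> real) \<Rightarrow> real^'n \<Rightarrow> real" where
  "left_partial i u x =
     Lim (at_left 0) (\<lambda>h. (u (x + h *\<^sub>R axis i 1) - left_lim i u x) / h)"

definition spec_A :: "real \<Rightarrow> real \<Rightarrow> real" where
  "spec_A \<alpha> \<beta> = (\<alpha> * \<beta> - 1 + sqrt ((\<alpha>\<^sup>2 + 1) * (\<beta>\<^sup>2 + 1))) / (\<alpha> + \<beta>)"

definition spec_mean :: "real \<Rightarrow> real \<Rightarrow> real" where
  "spec_mean \<alpha> \<beta> = (if \<alpha> + \<beta> \<noteq> 0 then spec_A \<alpha> \<beta> else 0)"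

definition has_spec_partial :: "'n \<Rightarrow> (real^'n \<Rightarrow> real) \<Rightarrow> real^'n \<Rightarrow> bool" where
  "has_spec_partial i u x \<longleftrightarrow>
     has_right_partial i u x \<and> has_left_partial i u x \<and> right_lim i u x = left_lim i u x"

definition spec_partial :: "'n \<Rightarrow> (real^'n \<Rightarrow> real) \<Rightarrow> real^'n \<Rightarrow> real" where
  "spec_partial i u x = spec_mean (right_partial i u x) (left_partial i u x)"

text \<open>
  A list \<open>[j\<^sub>1, \<dots>, j\<^sub>m]\<close> stands for the composition of the partial derivatives along
  \<open>j\<^sub>1, \<dots>, j\<^sub>m\<close>, the one along \<open>j\<^sub>m\<close> being applied first.  It exists on \<open>\<Omega>\<close> if every
  successive derivative exists at every point of \<open>\<Omega>\<close>.
\<close>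

definition spec_partials :: "'n list \<Rightarrow> (real^'n \<Rightarrow> real) \<Rightarrow> real^'n \<Rightarrow> real" where
  "spec_partials js u = foldr spec_partial js u"

primrec spec_partials_exist :: "(real^'n) set \<Rightarrow> 'n list \<Rightarrow> (real^'n \<Rightarrow> real) \<Rightarrow> bool" where
  "spec_partials_exist \<Omega> [] u \<longleftrightarrow> True"
| "spec_partials_exist \<Omega> (j # js) u \<longleftrightarrow>
     spec_partials_exist \<Omega> js u \<and> (\<forall>x\<in>\<Omega>. has_spec_partial j (spec_partials js u) x)"

text \<open>
  A multi-index is a function \<open>\<alpha>\<close> on the coordinate type, whose linear order fixes the order of
  differentiation: the largest coordinate is differentiated first, the smallest last.
\<close>

definition multi_index_list :: "('n::{finite,linorder} \<Rightarrow> nat) \<Rightarrow> 'n list" where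
  "multi_index_list \<alpha> = concat (map (\<lambda>i. replicate (\<alpha> i) i) (sorted_list_of_set UNIV))"

definition multi_index_order :: "('n::finite \<Rightarrow> nat) \<Rightarrow> nat" where
  "multi_index_order \<alpha> = (\<Sum>i\<in>UNIV. \<alpha> i)"

subsection \<open>Piecewise continuous and proper functions\<close>

text \<open>A singular hyperplane is represented by its graph.\<close>

definition singular_hyperplane ::
    "(real^'n) set \<Rightarrow> (real^'n \<Rightarrow> real) \<Rightarrow> (real^'n) set \<Rightarrow> bool" where
  "singular_hyperplane \<Omega> u G \<longleftrightarrow>
     (\<exists>X a b. X \<subseteq> \<Omega> \<and> connected X \<and> a \<noteq> 0 \<and> G = {x\<in>X. a \<bullet> x = b}) \<and>
     (\<exists>i. \<forall>x\<in>G. has_left_lim i u x \<and> has_right_lim i u x \<and> left_lim i u x \<noteq> right_lim i u x)"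

definition piecewise_continuous :: "(real^'n) set \<Rightarrow> (real^'n \<Rightarrow> real) \<Rightarrow> bool" where
  "piecewise_continuous \<Omega> u \<longleftrightarrow>
     (\<exists>H. finite H \<and> (\<forall>G\<in>H. singular_hyperplane \<Omega> u G) \<and>
        (\<forall>x \<in> \<Omega> - \<Union>H. continuous (at x within \<Omega>) u) \<and>
        (\<forall>G\<in>H. \<forall>x \<in> G - \<Union>(H - {G}). continuous (at x within G) u))"

definition proper_function :: "(real^'n) set \<Rightarrow> (real^'n \<Rightarrow> real) \<Rightarrow> bool" where
  "proper_function \<Omega> u \<longleftrightarrow> piecewise_continuous \<Omega> u \<and>
     (\<forall>a\<in>\<Omega>. \<forall>i. has_left_lim i u a \<and> has_right_lim i u a \<and>
        u a = spec_mean (left_lim i u a) (right_lim i u a))"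

subsection \<open>The function spaces\<close>

definition specular_space :: "nat \<Rightarrow> (real^'n::{finite,linorder}) set \<Rightarrow>
    (real^'n::{finite,linorder} \<Rightarrow> real) set" where
  "specular_space k \<Omega> =
     (if k = 0 then {u. proper_function \<Omega> u}
      else {u. continuous_on \<Omega> u \<and>
        (\<forall>\<alpha>. multi_index_order \<alpha> \<le> k \<longrightarrow>
           spec_partials_exist \<Omega> (multi_index_list \<alpha>) u \<and>
           proper_function \<Omega> (spec_partials (multi_index_list \<alpha>) u)) \<and>
        (\<forall>\<alpha>. multi_index_order \<alpha> + 2 \<le> k \<longrightarrow>
           (\<forall>i j. i \<noteq> j \<longrightarrow>
              spec_partials_exist \<Omega> (j # i # multi_index_list \<alpha>) u \<and>
              continuous_on \<Omega> (spec_partials (j # i # multi_index_list \<alpha>) u)))})"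

definition has_partial :: "'n \<Rightarrow> (real^'n \<Rightarrow> real) \<Rightarrow> real^'n \<Rightarrow> bool" where
  "has_partial i u x \<longleftrightarrow> (\<lambda>h. u (x + h *\<^sub>R axis i 1)) field_differentiable (at 0)"

definition partial_deriv :: "'n \<Rightarrow> (real^'n \<Rightarrow> real) \<Rightarrow> real^'n \<Rightarrow> real" where
  "partial_deriv i u x = deriv (\<lambda>h. u (x + h *\<^sub>R axis i 1)) 0"

definition partials :: "'n list \<Rightarrow> (real^'n \<Rightarrow> real) \<Rightarrow> real^'n \<Rightarrow> real" where
  "partials js u = foldr partial_deriv js u"

primrec partials_exist :: "(real^'n) set \<Rightarrow> 'n list \<Rightarrow> (real^'n \<Rightarrow> real) \<Rightarrow> bool" where
  "partials_exist \<Omega> [] u \<longleftrightarrow> True"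
| "partials_exist \<Omega> (j # js) u \<longleftrightarrow>
     partials_exist \<Omega> js u \<and> (\<forall>x\<in>\<Omega>. has_partial j (partials js u) x)"

text \<open>All partial derivatives up to order \<open>k\<close>, in every order of differentiation, exist and are
  continuous.\<close>

definition Ck_space :: "nat \<Rightarrow> (real^'n) set \<Rightarrow> (real^'n \<Rightarrow> real) set" where
  "Ck_space k \<Omega> =
     {u. \<forall>js. length js \<le> k \<longrightarrow> partials_exist \<Omega> js u \<and> continuous_on \<Omega> (partials js u)}"

end

theory Submission
  imports Defs
begin

text \<open>
  The specular derivative of a continuous function of one variable lies between the two one-sided
  derivatives, so a quasi mean value theorem bounds difference quotients by its extreme values;
  wherever it is continuous, it is therefore the classical derivative.

  If \<open>u\<close> belongs to \<open>S\<^sup>k\<^sup>+\<^sup>1\<close>, then a specular derivative \<open>v\<close> of \<open>u\<close> of order at most \<open>k\<close> is itself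
  specularly differentiable in every direction: in the direction differentiated last because
  \<open>v\<close> comes from a multi-index, in the others by the condition on mixed derivatives.  Hence its
  one-sided limits agree, \<open>v\<close> has no singular hyperplanes except empty ones, and \<open>v\<close> is
  continuous.  So all these specular derivatives are classical, and they may be reordered by the
  symmetry of mixed partial derivatives.
\<close>

section \<open>The specular mean\<close>

text \<open>The root collapses to \<open>a\<^sup>2 + 1\<close> and leaves
  \<open>2 * a\<^sup>2 / (2 * a)\<close>; at \<open>a = 0\<close> the default value 0 is the right
  one. Through this identity continuous functions are proper and classical derivatives are
  specular.\<close>

lemma spec_mean_self [simp]: "spec_mean a a = a"
proof -
  have "sqrt ((a\<^sup>2 + 1) * (a\<^sup>2 + 1)) = a\<^sup>2 + 1" by simp
  then show ?thesis
    unfolding spec_mean_def spec_A_def by (simp add: power2_eq_square field_simps)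
qed

lemma spec_mean_commute: "spec_mean a b = spec_mean b a"
  by (simp add: spec_mean_def spec_A_def ac_simps)

lemma spec_mean_minus: "spec_mean (- a) (- b) = - spec_mean a b"
proof -
  have "x / (- a - b) = - (x / (a + b))" for x
    using divide_minus_right[of x "a + b"] by simp
  then show ?thesis by (auto simp: spec_mean_def spec_A_def)
qed

text \<open>With \<open>s\<close> the geometric mean of \<open>a\<^sup>2 + 1\<close> and
  \<open>b\<^sup>2 + 1\<close>, the difference \<open>spec_mean a b - a\<close> is
  \<open>(s - (a\<^sup>2 + 1)) / (a + b)\<close>. The numerator has the sign of
  \<open>b\<^sup>2 - a\<^sup>2 = (b - a) * (a + b)\<close>, which for \<open>a \<le> b\<close> is
  never opposite to that of the denominator.\<close>

lemma spec_mean_ge_left: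
  assumes "a \<le> b"
  shows "a \<le> spec_mean a b"
proof (cases "a + b = 0")
  case True
  with assms show ?thesis by (simp add: spec_mean_def)
next
  case False
  define s where "s = sqrt ((a\<^sup>2 + 1) * (b\<^sup>2 + 1))"
  have diff: "spec_mean a b - a = (s - (a\<^sup>2 + 1)) / (a + b)"
    using False by (simp add: spec_mean_def spec_A_def s_def field_simps power2_eq_square)
  have sq: "sqrt ((a\<^sup>2 + 1) * (a\<^sup>2 + 1)) = a\<^sup>2 + 1"
    by simp
  have "b\<^sup>2 - a\<^sup>2 = (b - a) * (a + b)"
    by (simp add: power2_eq_square algebra_simps)
  show ?thesis
  proof (cases "a + b > 0")
    case True
    with assms have "0 \<le> (b - a) * (a + b)" by simp
    with \<open>b\<^sup>2 - a\<^sup>2 = _\<close> have "a\<^sup>2 \<le> b\<^sup>2" by linarith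
    then have "sqrt ((a\<^sup>2 + 1) * (a\<^sup>2 + 1)) \<le> s"
      unfolding s_def by (intro real_sqrt_le_mono mult_left_mono) auto
    then have "0 \<le> (s - (a\<^sup>2 + 1)) / (a + b)"
      using sq True by (intro divide_nonneg_pos) linarith+
    with diff show ?thesis by linarith
  next
    case neg: False
    with False assms have "(b - a) * (a + b) \<le> 0" by (simp add: mult_nonneg_nonpos)
    with \<open>b\<^sup>2 - a\<^sup>2 = _\<close> have "b\<^sup>2 \<le> a\<^sup>2" by linarith
    then have "s \<le> sqrt ((a\<^sup>2 + 1) * (a\<^sup>2 + 1))"
      unfolding s_def by (intro real_sqrt_le_mono mult_left_mono) auto
    then have "0 \<le> (s - (a\<^sup>2 + 1)) / (a + b)"
      using sq neg False by (intro divide_nonpos_neg) linarith+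
    with diff show ?thesis by linarith
  qed
qed

lemma spec_mean_ge:
  assumes "c \<le> a" "c \<le> b"
  shows "c \<le> spec_mean a b"
  using assms spec_mean_ge_left[of a b] spec_mean_ge_left[of b a] spec_mean_commute[of a b]
  by linarith

section \<open>Functions of one variable with one-sided derivatives\<close>

text \<open>Subtracting the line of slope \<open>c\<close> gives \<open>g\<close> with
  \<open>g a < g b\<close>. Let \<open>y\<close> be the level midway and \<open>s\<close> the
  infimum of the points above it: \<open>g\<close> is at most \<open>y\<close> before
  \<open>s\<close>, equals \<open>y\<close> at \<open>s\<close>, and exceeds \<open>y\<close>
  arbitrarily soon after \<open>s\<close>. So neither one-sided derivative of \<open>g\<close> at
  \<open>s\<close> is negative. That one point serves both sides is what a bound on the specular
  mean requires.\<close>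

lemma slope_le_one_sided_derivs:
  fixes f :: "real \<Rightarrow> real"
  assumes "a < b" and cont: "continuous_on {a..b} f" and slope: "c * (b - a) < f b - f a"
    and right: "\<And>x. a < x \<Longrightarrow> x < b \<Longrightarrow> ((\<lambda>h. (f (x + h) - f x) / h) \<longlongrightarrow> r x) (at_right 0)"
    and left: "\<And>x. a < x \<Longrightarrow> x < b \<Longrightarrow> ((\<lambda>h. (f (x + h) - f x) / h) \<longlongrightarrow> l x) (at_left 0)"
  obtains x where "a < x" "x < b" "c \<le> r x" "c \<le> l x"
proof -
  define g where "g x = f x - c * x" for x
  define y where "y = (g a + g b) / 2"
  define S where "S = {x\<in>{a..b}. y < g x}"
  define s where "s = Inf S"
  have gab: "g a < y" "y < g b"
    using slope by (simp_all add: g_def y_def field_simps)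
  have contg: "continuous_on {a..b} g"
    unfolding g_def by (intro continuous_intros cont)
  have bS: "b \<in> S" using gab \<open>a < b\<close> by (simp add: S_def)
  have bdd: "bdd_below S" by (auto simp: S_def bdd_below_def)
  have sa: "a \<le> s" unfolding s_def using bS by (intro cInf_greatest) (auto simp: S_def)
  have sb: "s \<le> b" unfolding s_def using bS bdd by (rule cInf_lower)
  have below: "g t \<le> y" if "a \<le> t" "t < s" for t
  proof (rule ccontr)
    assume "\<not> g t \<le> y"
    then have "t \<in> S" using that sb by (simp add: S_def)
    then have "s \<le> t" unfolding s_def using bdd by (intro cInf_lower)
    with that show False by simp
  qed
  have above: "\<exists>t. s \<le> t \<and> t < s + e \<and> t \<le> b \<and> y < g t" if "e > 0" for e
  proof -
    have "Inf S < s + e" using that by (simp add: s_def)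
    then obtain t where "t \<in> S" "t < s + e"
      using cInf_lessD[of S "s + e"] bS by blast
    moreover have "s \<le> t" unfolding s_def using bdd \<open>t \<in> S\<close> by (intro cInf_lower)
    ultimately show ?thesis by (auto simp: S_def)
  qed
  have near: "\<exists>d>0. \<forall>t\<in>{a..b}. \<bar>t - s\<bar> < d \<longrightarrow> \<bar>g t - g s\<bar> < e" if "e > 0" for e
    using contg[unfolded continuous_on_iff, rule_format, of s e] that sa sb
    by (auto simp: dist_real_def)
  have "g s \<le> y"
  proof (rule ccontr)
    assume *: "\<not> g s \<le> y"
    then obtain d where d: "d > 0" "\<And>t. t\<in>{a..b} \<Longrightarrow> \<bar>t - s\<bar> < d \<Longrightarrow> \<bar>g t - g s\<bar> < g s - y"
      using near[of "g s - y"] by auto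
    have "a < s" using * gab sa by (cases "a = s") auto
    define t where "t = max a (s - d / 2)"
    have "a \<le> t" "t < s" "\<bar>t - s\<bar> < d" using \<open>a < s\<close> d(1) by (auto simp: t_def)
    then have "\<bar>g t - g s\<bar> < g s - y" using sb by (intro d) auto
    with below[OF \<open>a \<le> t\<close> \<open>t < s\<close>] show False by linarith
  qed
  moreover have "y \<le> g s"
  proof (rule ccontr)
    assume *: "\<not> y \<le> g s"
    then obtain d where d: "d > 0" "\<And>t. t\<in>{a..b} \<Longrightarrow> \<bar>t - s\<bar> < d \<Longrightarrow> \<bar>g t - g s\<bar> < y - g s"
      using near[of "y - g s"] by auto
    obtain t where t: "s \<le> t" "t < s + d" "t \<le> b" "y < g t" using above[OF d(1)] by auto
    then have "\<bar>g t - g s\<bar> < y - g s" using sa by (intro d) auto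
    with t show False by linarith
  qed
  ultimately have gs: "g s = y" by simp
  have s: "a < s" "s < b" using gs gab sa sb by (auto simp: less_le)
  \<comment> \<open>A right derivative below \<open>c\<close> would keep \<open>g\<close> below
    \<open>y\<close> on an interval just after \<open>s\<close>, against
    \<open>above\<close>.\<close>
  have "c \<le> r s"
  proof (rule ccontr)
    assume "\<not> c \<le> r s"
    then have "\<forall>\<^sub>F h in at_right 0. (f (s + h) - f s) / h < c"
      by (intro order_tendstoD(2)[OF right[OF s]]) simp
    then obtain e where e: "e > 0" "\<And>h. 0 < h \<Longrightarrow> h < e \<Longrightarrow> (f (s + h) - f s) / h < c"
      by (auto simp: eventually_at_right[OF zero_less_one])
    obtain t where t: "s \<le> t" "t < s + e" "y < g t" using above[OF e(1)] by auto
    then have "t \<noteq> s" using gs by auto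
    with t have "(f (s + (t - s)) - f s) / (t - s) < c" by (intro e) auto
    then have "f t - f s < c * (t - s)" using \<open>t \<noteq> s\<close> t by (simp add: pos_divide_less_eq)
    with t gs show False by (simp add: g_def algebra_simps)
  qed
  moreover have "c \<le> l s"
  proof (rule ccontr)
    assume "\<not> c \<le> l s"
    then have "\<forall>\<^sub>F h in at_left 0. (f (s + h) - f s) / h < c"
      by (intro order_tendstoD(2)[OF left[OF s]]) simp
    then obtain e where e: "e < 0" "\<And>h. e < h \<Longrightarrow> h < 0 \<Longrightarrow> (f (s + h) - f s) / h < c"
      by (auto simp: eventually_at_left[of "-1" "0 :: real"])
    \<comment> \<open>Here \<open>e\<close> is negative: halving it keeps \<open>t - s\<close>
      within the range of the estimate, and the maximum with \<open>a\<close> keeps \<open>t\<close>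
      within the range of \<open>below\<close>.\<close>
    define t where "t = max a (s + e / 2)"
    have t: "a \<le> t" "t < s" "s + e < t" using s e(1) by (auto simp: t_def)
    then have "(f (s + (t - s)) - f s) / (t - s) < c" by (intro e) auto
    then have "c * (t - s) < f t - f s" using t by (simp add: neg_divide_less_eq)
    with below[OF t(1,2)] gs show False by (simp add: g_def algebra_simps)
  qed
  ultimately show ?thesis using s that by blast
qed

text \<open>If the slope exceeded \<open>M\<close>, a \<open>c\<close> strictly between them would
  yield a point where both one-sided derivatives, and so their specular mean, are at least
  \<open>c > M\<close>.\<close>

lemma slope_le_spec_mean_bound:
  fixes f :: "real \<Rightarrow> real"
  assumes "a < b" and "continuous_on {a..b} f"
    and "\<And>x. a < x \<Longrightarrow> x < b \<Longrightarrow> ((\<lambda>h. (f (x + h) - f x) / h) \<longlongrightarrow> r x) (at_right 0)"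
    and "\<And>x. a < x \<Longrightarrow> x < b \<Longrightarrow> ((\<lambda>h. (f (x + h) - f x) / h) \<longlongrightarrow> l x) (at_left 0)"
    and bound: "\<And>x. a < x \<Longrightarrow> x < b \<Longrightarrow> spec_mean (r x) (l x) \<le> M"
  shows "f b - f a \<le> M * (b - a)"
proof (rule ccontr)
  assume "\<not> ?thesis"
  then have "M < (f b - f a) / (b - a)"
    using \<open>a < b\<close> by (subst pos_less_divide_eq) (simp_all only: not_le diff_gt_0_iff_gt)
  then obtain c where c: "M < c" "c < (f b - f a) / (b - a)" using dense by blast
  with \<open>a < b\<close> have "c * (b - a) < f b - f a"
    using pos_less_divide_eq[of "b - a" c "f b - f a"] by simp
  then obtain x where "a < x" "x < b" "c \<le> r x" "c \<le> l x"
    using slope_le_one_sided_derivs[OF assms(1,2) _ assms(3,4)] by blast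
  with bound[of x] spec_mean_ge[of c "r x" "l x"] c show False by linarith
qed

text \<open>Apply the upper bound to the negative of \<open>f\<close>; \<open>spec_mean\<close> is
  odd.\<close>

lemma slope_ge_spec_mean_bound:
  fixes f :: "real \<Rightarrow> real"
  assumes "a < b" and "continuous_on {a..b} f"
    and right: "\<And>x. a < x \<Longrightarrow> x < b \<Longrightarrow> ((\<lambda>h. (f (x + h) - f x) / h) \<longlongrightarrow> r x) (at_right 0)"
    and left: "\<And>x. a < x \<Longrightarrow> x < b \<Longrightarrow> ((\<lambda>h. (f (x + h) - f x) / h) \<longlongrightarrow> l x) (at_left 0)"
    and bound: "\<And>x. a < x \<Longrightarrow> x < b \<Longrightarrow> M \<le> spec_mean (r x) (l x)"
  shows "M * (b - a) \<le> f b - f a"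
proof -
  have neg: "(\<lambda>h. (- f (x + h) - - f x) / h) = (\<lambda>h. - ((f (x + h) - f x) / h))" for x
    by (auto simp: divide_simps)
  have "- f b - - f a \<le> - M * (b - a)"
  proof (rule slope_le_spec_mean_bound[where r = "\<lambda>x. - r x" and l = "\<lambda>x. - l x"])
    show "continuous_on {a..b} (\<lambda>x. - f x)" by (intro continuous_intros assms)
    show "spec_mean (- r x) (- l x) \<le> - M" if "a < x" "x < b" for x
      using bound[OF that] by (simp add: spec_mean_minus)
  qed (use \<open>a < b\<close> in \<open>auto simp only: neg intro!: tendsto_minus right left\<close>)
  then show ?thesis by simp
qed

text \<open>Near \<open>x0\<close> the specular means stay within \<open>e / 2\<close> of their
  value at \<open>x0\<close>, and the two slope bounds pass this on to every difference quotient
  over an interval there. The slope bounds are weak inequalities, so \<open>e / 2\<close> secures a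
  strict one.\<close>

lemma has_field_derivative_spec_mean:
  fixes f :: "real \<Rightarrow> real"
  assumes "open S" "x0 \<in> S" and cont: "continuous_on S f"
    and right: "\<And>x. x \<in> S \<Longrightarrow> ((\<lambda>h. (f (x + h) - f x) / h) \<longlongrightarrow> r x) (at_right 0)"
    and left: "\<And>x. x \<in> S \<Longrightarrow> ((\<lambda>h. (f (x + h) - f x) / h) \<longlongrightarrow> l x) (at_left 0)"
    and contD: "isCont (\<lambda>x. spec_mean (r x) (l x)) x0"
  shows "(f has_field_derivative spec_mean (r x0) (l x0)) (at x0)"
  unfolding DERIV_def LIM_eq
proof (intro allI impI)
  fix e :: real assume "e > 0"
  define D where "D = spec_mean (r x0) (l x0)"
  obtain d1 where d1: "d1 > 0" "ball x0 d1 \<subseteq> S"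
    using assms(1,2) open_contains_ball by blast
  obtain d2 where d2: "d2 > 0"
      "\<And>x. dist x x0 < d2 \<Longrightarrow> dist (spec_mean (r x) (l x)) D < e / 2"
    using contD \<open>e > 0\<close> unfolding continuous_at_eps_delta D_def by (meson half_gt_zero)
  define d where "d = min d1 d2"
  have inS: "x \<in> S" if "\<bar>x - x0\<bar> < d" for x
    using d1 that by (auto simp: d_def dist_real_def subset_iff abs_minus_commute)
  have near: "D - e / 2 \<le> spec_mean (r x) (l x)" "spec_mean (r x) (l x) \<le> D + e / 2"
    if "\<bar>x - x0\<bar> < d" for x
    using d2(2)[of x] that by (auto simp: d_def dist_real_def abs_if split: if_splits)
  \<comment> \<open>The end points are left general because \<open>x0\<close> is the left end for
    positive \<open>h\<close> and the right end for negative \<open>h\<close>.\<close>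
  have slope: "(D - e / 2) * (b - a) \<le> f b - f a \<and> f b - f a \<le> (D + e / 2) * (b - a)"
    if "a < b" "\<bar>a - x0\<bar> < d" "\<bar>b - x0\<bar> < d" for a b
  proof -
    have *: "\<bar>x - x0\<bar> < d" if "a \<le> x" "x \<le> b" for x
      using that \<open>\<bar>a - x0\<bar> < d\<close> \<open>\<bar>b - x0\<bar> < d\<close> by linarith
    have "continuous_on {a..b} f"
      by (rule continuous_on_subset[OF cont]) (use * inS in auto)
    with \<open>a < b\<close> * show ?thesis
      by (intro conjI slope_le_spec_mean_bound[where r = r and l = l]
          slope_ge_spec_mean_bound[where r = r and l = l] right left near inS) auto
  qed
  have "norm ((f (x0 + h) - f x0) / h - D) < e" if "h \<noteq> 0" "norm (h - 0) < d" for h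
  proof -
    have "D - e / 2 \<le> (f (x0 + h) - f x0) / h \<and> (f (x0 + h) - f x0) / h \<le> D + e / 2"
    proof (cases "h > 0")
      case True
      with slope[of x0 "x0 + h"] that d1 d2 show ?thesis
        by (simp add: d_def field_simps)
    next
      case False
      with that have "h < 0" by simp
      with slope[of "x0 + h" x0] that d1 d2
      have "(D - e / 2) * (- h) \<le> f x0 - f (x0 + h)" "f x0 - f (x0 + h) \<le> (D + e / 2) * (- h)"
        by (simp_all add: d_def)
      then show ?thesis
        unfolding neg_le_divide_eq[OF \<open>h < 0\<close>] neg_divide_le_eq[OF \<open>h < 0\<close>]
        by (simp add: algebra_simps)
    qed
    with \<open>e > 0\<close> show ?thesis by (simp add: abs_if)
  qed
  with d1 d2 show "\<exists>d>0. \<forall>h. h \<noteq> 0 \<and> norm (h - 0) < d \<longrightarrow>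
      norm ((f (x0 + h) - f x0) / h - spec_mean (r x0) (l x0)) < e"
    by (intro exI[of _ d]) (auto simp: d_def D_def)
qed

section \<open>Specular and classical partial derivatives\<close>

text \<open>The definition differentiates at parameter 0 along a line starting at the point itself;
  shifting the parameter allows the mean value theorem to run along one fixed line.\<close>

lemma has_partialD:
  assumes "has_partial i u (x + s *\<^sub>R axis i 1)"
  shows "((\<lambda>s. u (x + s *\<^sub>R axis i 1)) has_field_derivative
    partial_deriv i u (x + s *\<^sub>R axis i 1)) (at s)"
proof -
  have "((\<lambda>h. u (x + (s + h) *\<^sub>R axis i 1)) has_field_derivative
      partial_deriv i u (x + s *\<^sub>R axis i 1)) (at 0)"
    using assms by (simp add: has_partial_def partial_deriv_def scaleR_add_left add.assoc
        flip: DERIV_deriv_iff_field_differentiable)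
  then show ?thesis
    using DERIV_shift[of "\<lambda>s. u (x + s *\<^sub>R axis i 1)" _ 0 s] by (simp add: add.commute)
qed

lemma has_partialI:
  assumes "((\<lambda>h. u (x + h *\<^sub>R axis i 1)) has_field_derivative D) (at 0)"
  shows "has_partial i u x" "partial_deriv i u x = D"
  using assms by (auto simp: has_partial_def partial_deriv_def field_differentiable_def
      intro: DERIV_imp_deriv)

lemma open_line:
  fixes x :: "real^'n"
  assumes "open \<Omega>"
  shows "open {t. x + t *\<^sub>R axis i 1 \<in> \<Omega>}"
  using open_vimage[OF assms, of "\<lambda>t. x + t *\<^sub>R axis i 1"]
  by (simp add: vimage_def continuous_intros)

text \<open>Near the point the line stays inside the open set. Iterated derivatives are compared
  only on \<Omega>, and this lemma allows such an equality to be differentiated.\<close>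

lemma partial_cong:
  fixes x :: "real^'n"
  assumes "open \<Omega>" "x \<in> \<Omega>" and eq: "\<And>y. y \<in> \<Omega> \<Longrightarrow> u y = v y" and "has_partial i u x"
  shows "has_partial i v x" "partial_deriv i v x = partial_deriv i u x"
proof -
  have "((\<lambda>h. u (x + h *\<^sub>R axis i 1)) has_field_derivative partial_deriv i u x) (at 0)"
    using has_partialD[of i u x 0] assms(4) by simp
  then have "((\<lambda>h. v (x + h *\<^sub>R axis i 1)) has_field_derivative partial_deriv i u x) (at 0)"
    by (rule has_field_derivative_transform_within_open[OF _ open_line[OF assms(1)]])
      (use eq assms(2) in auto)
  from has_partialI[OF this]
  show "has_partial i v x" "partial_deriv i v x = partial_deriv i u x" .
qed

lemma right_limI:
  assumes "((\<lambda>h. u (x + h *\<^sub>R axis i 1)) \<longlongrightarrow> l) (at_right 0)"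
  shows "has_right_lim i u x" "right_lim i u x = l"
  using assms by (auto simp: has_right_lim_def right_lim_def intro: tendsto_Lim)

lemma left_limI:
  assumes "((\<lambda>h. u (x + h *\<^sub>R axis i 1)) \<longlongrightarrow> l) (at_left 0)"
  shows "has_left_lim i u x" "left_lim i u x = l"
  using assms by (auto simp: has_left_lim_def left_lim_def intro: tendsto_Lim)

lemma one_sided_lims_isCont:
  assumes "isCont (\<lambda>h. u (x + h *\<^sub>R axis i 1)) 0"
  shows "has_right_lim i u x" "right_lim i u x = u x"
    "has_left_lim i u x" "left_lim i u x = u x"
proof -
  have "((\<lambda>h. u (x + h *\<^sub>R axis i 1)) \<longlongrightarrow> u x) (at 0)"
    using assms by (simp add: isCont_def)
  then have "((\<lambda>h. u (x + h *\<^sub>R axis i 1)) \<longlongrightarrow> u x) (at_right 0)"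
    "((\<lambda>h. u (x + h *\<^sub>R axis i 1)) \<longlongrightarrow> u x) (at_left 0)"
    by (simp_all add: filterlim_at_split)
  then show "has_right_lim i u x" "right_lim i u x = u x"
    "has_left_lim i u x" "left_lim i u x = u x"
    by (auto intro: right_limI left_limI)
qed

lemma continuous_on_line:
  fixes x :: "real^'n"
  assumes "continuous_on \<Omega> u"
  shows "continuous_on {t. x + t *\<^sub>R axis i 1 \<in> \<Omega>} (\<lambda>t. u (x + t *\<^sub>R axis i 1))"
  by (intro continuous_on_compose2[OF assms] continuous_intros) auto

lemma isCont_line:
  fixes x :: "real^'n"
  assumes "open \<Omega>" "continuous_on \<Omega> u" "x + t *\<^sub>R axis i 1 \<in> \<Omega>"
  shows "isCont (\<lambda>t. u (x + t *\<^sub>R axis i 1)) t"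
  using continuous_on_line[OF assms(2)] assms(3)
  by (simp add: continuous_on_eq_continuous_at[OF open_line[OF assms(1)]])

text \<open>Both one-sided quotients tend to the classical derivative, and \<open>spec_mean\<close>
  returns the common value of equal arguments.\<close>

lemma has_spec_partial_of_has_partial:
  assumes "has_partial i u x"
  shows "has_spec_partial i u x" "spec_partial i u x = partial_deriv i u x"
proof -
  have D: "((\<lambda>h. u (x + h *\<^sub>R axis i 1)) has_field_derivative partial_deriv i u x) (at 0)"
    using has_partialD[of i u x 0] assms by simp
  note lims = one_sided_lims_isCont[OF DERIV_isCont[OF D]]
  have "((\<lambda>h. (u (x + h *\<^sub>R axis i 1) - u x) / h) \<longlongrightarrow> partial_deriv i u x) (at 0)"
    using D by (simp add: DERIV_def)
  then have
    R: "((\<lambda>h. (u (x + h *\<^sub>R axis i 1) - u x) / h) \<longlongrightarrow> partial_deriv i u x) (at_right 0)" and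
    L: "((\<lambda>h. (u (x + h *\<^sub>R axis i 1) - u x) / h) \<longlongrightarrow> partial_deriv i u x) (at_left 0)"
    by (auto simp: filterlim_at_split)
  show "has_spec_partial i u x"
    using R L lims by (auto simp: has_spec_partial_def has_right_partial_def has_left_partial_def)
  show "spec_partial i u x = partial_deriv i u x"
    using R L lims by (simp add: spec_partial_def right_partial_def left_partial_def tendsto_Lim)
qed

text \<open>Continuity identifies the one-sided limits in the specular quotients with the value of
  \<open>u\<close>. Along the line through \<open>x\<close> they are thus ordinary one-sided
  quotients, and \<open>has_field_derivative_spec_mean\<close> applies.\<close>

lemma has_partial_of_has_spec_partial:
  fixes \<Omega> :: "(real^'n) set"
  assumes "open \<Omega>" and cont: "continuous_on \<Omega> u"
    and spec: "\<And>x. x \<in> \<Omega> \<Longrightarrow> has_spec_partial i u x"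
    and contD: "continuous_on \<Omega> (spec_partial i u)" and "x \<in> \<Omega>"
  shows "has_partial i u x" "partial_deriv i u x = spec_partial i u x"
proof -
  define S where "S = {t. x + t *\<^sub>R axis i 1 \<in> \<Omega>}"
  define r where "r t = right_partial i u (x + t *\<^sub>R axis i 1)" for t
  define l where "l t = left_partial i u (x + t *\<^sub>R axis i 1)" for t
  have lims: "right_lim i u y = u y" "left_lim i u y = u y" if "y \<in> \<Omega>" for y
    using one_sided_lims_isCont[OF isCont_line[OF assms(1) cont, of y 0]] that by simp_all
  have "((\<lambda>t. u (x + t *\<^sub>R axis i 1)) has_field_derivative spec_mean (r 0) (l 0)) (at 0)"
  proof (rule has_field_derivative_spec_mean)
    show "open S" unfolding S_def by (rule open_line[OF assms(1)])
    show "0 \<in> S" using \<open>x \<in> \<Omega>\<close> by (simp add: S_def)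
    show "continuous_on S (\<lambda>t. u (x + t *\<^sub>R axis i 1))"
      unfolding S_def by (rule continuous_on_line[OF cont])
    show "isCont (\<lambda>t. spec_mean (r t) (l t)) 0"
      using isCont_line[OF assms(1) contD, of x 0] \<open>x \<in> \<Omega>\<close>
      by (simp add: spec_partial_def r_def l_def)
    fix t assume "t \<in> S"
    then have y: "x + t *\<^sub>R axis i 1 \<in> \<Omega>" by (simp add: S_def)
    show "((\<lambda>h. (u (x + (t + h) *\<^sub>R axis i 1) - u (x + t *\<^sub>R axis i 1)) / h) \<longlongrightarrow> r t) (at_right 0)"
      using spec[OF y] lims[OF y]
      by (auto simp: has_spec_partial_def has_right_partial_def right_partial_def r_def
          scaleR_add_left add.assoc tendsto_Lim)
    show "((\<lambda>h. (u (x + (t + h) *\<^sub>R axis i 1) - u (x + t *\<^sub>R axis i 1)) / h) \<longlongrightarrow> l t) (at_left 0)"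
      using spec[OF y] lims[OF y]
      by (auto simp: has_spec_partial_def has_left_partial_def left_partial_def l_def
          scaleR_add_left add.assoc tendsto_Lim)
  qed
  then show "has_partial i u x" "partial_deriv i u x = spec_partial i u x"
    by (auto simp: spec_partial_def r_def l_def dest: has_partialI)
qed

section \<open>Equality of mixed partial derivatives\<close>

text \<open>The mean value theorem is used twice on a square of side \<open>h\<close>: in direction
  \<open>i\<close> for the difference \<open>F\<close> between two parallel sides, then in direction
  \<open>j\<close> for the resulting difference of first derivatives.\<close>

lemma second_difference_eq_mixed_partial:
  fixes z :: "real^'n \<Rightarrow> real"
  assumes "h > 0"
    and box: "\<And>s t. 0 \<le> s \<Longrightarrow> s \<le> h \<Longrightarrow> 0 \<le> t \<Longrightarrow> t \<le> h \<Longrightarrow>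
      x + s *\<^sub>R axis i 1 + t *\<^sub>R axis j 1 \<in> \<Omega>"
    and i: "\<And>y. y \<in> \<Omega> \<Longrightarrow> has_partial i z y"
    and ij: "\<And>y. y \<in> \<Omega> \<Longrightarrow> has_partial j (partial_deriv i z) y"
  obtains s t where "0 < s" "s < h" "0 < t" "t < h"
    "z (x + h *\<^sub>R axis i 1 + h *\<^sub>R axis j 1) - z (x + h *\<^sub>R axis i 1) - z (x + h *\<^sub>R axis j 1) + z x
      = h * (h * partial_deriv j (partial_deriv i z) (x + s *\<^sub>R axis i 1 + t *\<^sub>R axis j 1))"
proof -
  define F where "F s = z ((x + h *\<^sub>R axis j 1) + s *\<^sub>R axis i 1) - z (x + s *\<^sub>R axis i 1)" for s
  have "\<exists>s. 0 < s \<and> s < h \<and> F h - F 0 = (h - 0) *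
    (partial_deriv i z ((x + h *\<^sub>R axis j 1) + s *\<^sub>R axis i 1)
      - partial_deriv i z (x + s *\<^sub>R axis i 1))"
  proof (rule MVT2[OF \<open>h > 0\<close>])
    fix s assume "0 \<le> s" "s \<le> h"
    then show "(F has_field_derivative
        partial_deriv i z ((x + h *\<^sub>R axis j 1) + s *\<^sub>R axis i 1)
          - partial_deriv i z (x + s *\<^sub>R axis i 1)) (at s)"
      unfolding F_def
      using box[of s h] box[of s 0] \<open>h > 0\<close>
      by (intro derivative_intros has_partialD i) (auto simp: ac_simps)
  qed
  then obtain s where s: "0 < s" "s < h" "F h - F 0 = h *
      (partial_deriv i z (x + s *\<^sub>R axis i 1 + h *\<^sub>R axis j 1)
        - partial_deriv i z (x + s *\<^sub>R axis i 1))"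
    by (auto simp: ac_simps)
  define G where "G t = partial_deriv i z ((x + s *\<^sub>R axis i 1) + t *\<^sub>R axis j 1)" for t
  have "\<exists>t. 0 < t \<and> t < h \<and> G h - G 0 = (h - 0) *
    partial_deriv j (partial_deriv i z) ((x + s *\<^sub>R axis i 1) + t *\<^sub>R axis j 1)"
    unfolding G_def using s box
    by (intro MVT2[OF \<open>h > 0\<close>] has_partialD ij) auto
  with s that show ?thesis by (auto simp: F_def G_def ac_simps algebra_simps)
qed

text \<open>The second difference over a small square does not depend on the order of
  \<open>i\<close> and \<open>j\<close>, so the two mixed derivatives share a value, each at its own
  point of the square. Continuity at \<open>x\<close> then rules out a gap between them.\<close>

lemma mixed_partials_commute:
  fixes z :: "real^'n \<Rightarrow> real"
  assumes "open \<Omega>" "x \<in> \<Omega>"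
    and i: "\<And>y. y \<in> \<Omega> \<Longrightarrow> has_partial i z y"
    and j: "\<And>y. y \<in> \<Omega> \<Longrightarrow> has_partial j z y"
    and ij: "\<And>y. y \<in> \<Omega> \<Longrightarrow> has_partial j (partial_deriv i z) y"
    and ji: "\<And>y. y \<in> \<Omega> \<Longrightarrow> has_partial i (partial_deriv j z) y"
    and cij: "continuous_on \<Omega> (partial_deriv j (partial_deriv i z))" (is "continuous_on _ ?P")
    and cji: "continuous_on \<Omega> (partial_deriv i (partial_deriv j z))" (is "continuous_on _ ?Q")
  shows "partial_deriv j (partial_deriv i z) x = partial_deriv i (partial_deriv j z) x"
proof (rule ccontr)
  assume "?P x \<noteq> ?Q x"
  \<comment> \<open>Half the gap, so that two errors below \<open>e\<close> cannot bridge
    it.\<close>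
  define e where "e = \<bar>?P x - ?Q x\<bar> / 2"
  have "e > 0" using \<open>?P x \<noteq> ?Q x\<close> by (simp add: e_def)
  obtain d0 where d0: "d0 > 0" "ball x d0 \<subseteq> \<Omega>" using assms(1,2) open_contains_ball by blast
  obtain d1 where d1: "d1 > 0" "\<And>y. y \<in> \<Omega> \<Longrightarrow> dist y x < d1 \<Longrightarrow> dist (?P y) (?P x) < e"
    using cij \<open>e > 0\<close> \<open>x \<in> \<Omega>\<close> unfolding continuous_on_iff by metis
  obtain d2 where d2: "d2 > 0" "\<And>y. y \<in> \<Omega> \<Longrightarrow> dist y x < d2 \<Longrightarrow> dist (?Q y) (?Q x) < e"
    using cji \<open>e > 0\<close> \<open>x \<in> \<Omega>\<close> unfolding continuous_on_iff by metis
  define d where "d = min d0 (min d1 d2)"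
  \<comment> \<open>Two displacements of at most \<open>h\<close> add up to at most
    \<open>2 * d / 3 < d\<close>.\<close>
  define h where "h = d / 3"
  have "d > 0" "h > 0" using d0 d1 d2 by (auto simp: d_def h_def)
  have close: "dist (x + s *\<^sub>R axis k 1 + t *\<^sub>R axis k' 1) x < d"
    if "0 \<le> s" "s \<le> h" "0 \<le> t" "t \<le> h" for s t and k k' :: 'n
  proof -
    have "dist (x + s *\<^sub>R axis k 1 + t *\<^sub>R axis k' 1) x
        = norm (s *\<^sub>R axis k 1 + t *\<^sub>R axis k' 1 :: real^'n)"
      by (simp add: dist_norm)
    also have "\<dots> \<le> norm (s *\<^sub>R axis k 1 :: real^'n) + norm (t *\<^sub>R axis k' 1 :: real^'n)"
      by (rule norm_triangle_ineq)
    also have "\<dots> = s + t" using that by simp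
    finally show ?thesis using that \<open>d > 0\<close> by (simp add: h_def)
  qed
  then have box: "x + s *\<^sub>R axis k 1 + t *\<^sub>R axis k' 1 \<in> \<Omega>"
    if "0 \<le> s" "s \<le> h" "0 \<le> t" "t \<le> h" for s t and k k' :: 'n
    using d0(2) that by (force simp: d_def dist_commute)
  obtain s t where st: "0 < s" "s < h" "0 < t" "t < h"
    "z (x + h *\<^sub>R axis i 1 + h *\<^sub>R axis j 1) - z (x + h *\<^sub>R axis i 1) - z (x + h *\<^sub>R axis j 1) + z x
      = h * (h * ?P (x + s *\<^sub>R axis i 1 + t *\<^sub>R axis j 1))"
    by (rule second_difference_eq_mixed_partial[OF \<open>h > 0\<close> box i ij])
  obtain s' t' where st': "0 < s'" "s' < h" "0 < t'" "t' < h"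
    "z (x + h *\<^sub>R axis j 1 + h *\<^sub>R axis i 1) - z (x + h *\<^sub>R axis j 1) - z (x + h *\<^sub>R axis i 1) + z x
      = h * (h * ?Q (x + s' *\<^sub>R axis j 1 + t' *\<^sub>R axis i 1))"
    by (rule second_difference_eq_mixed_partial[OF \<open>h > 0\<close> box j ji])
  have "h * (h * ?P (x + s *\<^sub>R axis i 1 + t *\<^sub>R axis j 1))
      = h * (h * ?Q (x + s' *\<^sub>R axis j 1 + t' *\<^sub>R axis i 1))"
    unfolding st(5)[symmetric] st'(5)[symmetric] by (simp add: ac_simps)
  with \<open>h > 0\<close> have eq: "?P (x + s *\<^sub>R axis i 1 + t *\<^sub>R axis j 1)
      = ?Q (x + s' *\<^sub>R axis j 1 + t' *\<^sub>R axis i 1)"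
    by simp
  have "dist (?P (x + s *\<^sub>R axis i 1 + t *\<^sub>R axis j 1)) (?P x) < e"
    using st close[of s t i j] by (intro d1 box) (auto simp: d_def)
  moreover have "dist (?Q (x + s' *\<^sub>R axis j 1 + t' *\<^sub>R axis i 1)) (?Q x) < e"
    using st' close[of s' t' j i] by (intro d2 box) (auto simp: d_def)
  ultimately have "dist (?P x) (?Q x) < e + e"
    unfolding eq by (metis dist_commute dist_triangle_less_add)
  moreover have "dist (?P x) (?Q x) = e + e"
    unfolding dist_real_def e_def by (rule field_sum_of_halves[symmetric])
  ultimately show False by (metis less_irrefl)
qed

section \<open>Proper functions\<close>

text \<open>The empty family of hyperplanes witnesses piecewise continuity, and both one-sided
  limits are the value at the point, which \<open>spec_mean\<close> returns.\<close>

lemma proper_function_of_continuous_on: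
  fixes \<Omega> :: "(real^'n) set"
  assumes "open \<Omega>" "continuous_on \<Omega> u"
  shows "proper_function \<Omega> u"
proof -
  have "piecewise_continuous \<Omega> u"
    unfolding piecewise_continuous_def
    by (intro exI[of _ "{}"]) (use assms in \<open>auto simp: continuous_on_eq_continuous_within\<close>)
  moreover have "has_left_lim i u a \<and> has_right_lim i u a \<and>
      u a = spec_mean (left_lim i u a) (right_lim i u a)" if "a \<in> \<Omega>" for a i
    using one_sided_lims_isCont[OF isCont_line[OF assms, of a 0]] that by simp
  ultimately show ?thesis by (simp add: proper_function_def)
qed

text \<open>At a point of a singular hyperplane the one-sided limits differ in some direction,
  whereas a specular derivative in that direction forces them to agree. So every member of
  \<open>H\<close> is an empty graph and no exceptional points remain.\<close>

lemma continuous_on_of_proper_function: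
  fixes \<Omega> :: "(real^'n) set"
  assumes "proper_function \<Omega> u" and "\<And>x i. x \<in> \<Omega> \<Longrightarrow> has_spec_partial i u x"
  shows "continuous_on \<Omega> u"
proof -
  obtain H where H: "\<forall>G\<in>H. singular_hyperplane \<Omega> u G"
      "\<forall>x\<in>\<Omega> - \<Union>H. continuous (at x within \<Omega>) u"
    using assms(1) unfolding proper_function_def piecewise_continuous_def
    by (elim conjE exE) (rule that)
  have "G = {}" if "G \<in> H" for G
  proof -
    have G: "singular_hyperplane \<Omega> u G" using H(1) that by simp
    then have "G \<subseteq> \<Omega>"
      unfolding singular_hyperplane_def by auto
    moreover obtain i where "\<forall>x\<in>G. left_lim i u x \<noteq> right_lim i u x"
      using G unfolding singular_hyperplane_def by auto
    moreover note assms(2)[of _ i]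
    ultimately show ?thesis unfolding has_spec_partial_def by (metis equals0I subsetD)
  qed
  then have "\<Union>H = {}" by blast
  with H(2) show ?thesis by (simp add: continuous_on_eq_continuous_within)
qed

section \<open>Multi-indices as sorted lists\<close>

lemma sorted_multi_index_list: "sorted (multi_index_list \<alpha>)"
proof -
  have "sorted (concat (map (\<lambda>i. replicate (\<alpha> i) i) xs))" if "sorted xs" for xs
    using that by (induction xs) (auto simp: sorted_append)
  then show ?thesis unfolding multi_index_list_def by simp
qed

lemma count_list_multi_index_list: "count_list (multi_index_list \<alpha>) i = \<alpha> i"
proof -
  have rep: "count_list (replicate n a) b = (if a = b then n else 0)" for n and a b :: 'a
    by (induction n) auto
  have "count_list (concat (map (\<lambda>i. replicate (\<alpha> i) i) xs)) i = (if i \<in> set xs then \<alpha> i else 0)"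
    if "distinct xs" for xs
    using that by (induction xs) (auto simp: count_list_append rep)
  then show ?thesis unfolding multi_index_list_def by simp
qed

text \<open>A sorted list is determined by its multiplicities; multi-indices thus correspond exactly
  to sorted lists.\<close>

lemma multi_index_list_count_list:
  fixes js :: "'n::{finite,linorder} list"
  assumes "sorted js"
  shows "multi_index_list (count_list js) = js"
proof -
  have "mset (multi_index_list (count_list js)) = mset js"
    by (simp add: multiset_eq_iff count_mset count_list_multi_index_list)
  then have "sort js = multi_index_list (count_list js)"
    by (rule properties_for_sort) (rule sorted_multi_index_list)
  with assms show ?thesis by (simp add: sorted_sort_id)
qed

lemma multi_index_order_count_list:
  fixes js :: "'n::finite list"
  shows "multi_index_order (count_list js) = length js"
  unfolding multi_index_order_def by (rule sum_count_set) auto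

lemma multi_index_order_eq_length: "multi_index_order \<alpha> = length (multi_index_list \<alpha>)"
  using multi_index_order_count_list[of "multi_index_list \<alpha>"]
  by (simp add: count_list_multi_index_list multi_index_order_def)

text \<open>Trades multi-indices for sorted lists, on which induction is possible. The lists
  \<open>j # i # js\<close> of the mixed condition need not be sorted.\<close>

lemma specular_space_iff:
  assumes "k \<ge> 1"
  shows "u \<in> specular_space k \<Omega> \<longleftrightarrow> continuous_on \<Omega> u \<and>
    (\<forall>js. sorted js \<and> length js \<le> k \<longrightarrow>
      spec_partials_exist \<Omega> js u \<and> proper_function \<Omega> (spec_partials js u)) \<and>
    (\<forall>js i j. sorted js \<and> length js + 2 \<le> k \<and> i \<noteq> j \<longrightarrow>
      spec_partials_exist \<Omega> (j # i # js) u \<and>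
      continuous_on \<Omega> (spec_partials (j # i # js) u))"
proof -
  have all: "(\<forall>\<alpha>. P (multi_index_list \<alpha>)) \<longleftrightarrow> (\<forall>js. sorted js \<longrightarrow> P js)" for P :: "'a list \<Rightarrow> bool"
    using sorted_multi_index_list multi_index_list_count_list by metis
  have "u \<in> specular_space k \<Omega> \<longleftrightarrow> continuous_on \<Omega> u \<and>
    (\<forall>\<alpha>. length (multi_index_list \<alpha>) \<le> k \<longrightarrow>
      spec_partials_exist \<Omega> (multi_index_list \<alpha>) u \<and>
      proper_function \<Omega> (spec_partials (multi_index_list \<alpha>) u)) \<and>
    (\<forall>\<alpha>. length (multi_index_list \<alpha>) + 2 \<le> k \<longrightarrow> (\<forall>i j. i \<noteq> j \<longrightarrow>
      spec_partials_exist \<Omega> (j # i # multi_index_list \<alpha>) u \<and>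
      continuous_on \<Omega> (spec_partials (j # i # multi_index_list \<alpha>) u)))"
    using assms unfolding specular_space_def multi_index_order_eq_length
    by (simp del: spec_partials_exist.simps)
  then show ?thesis
    unfolding all[of "\<lambda>js. length js \<le> k \<longrightarrow> spec_partials_exist \<Omega> js u \<and>
        proper_function \<Omega> (spec_partials js u)"]
      all[of "\<lambda>js. length js + 2 \<le> k \<longrightarrow> (\<forall>i j. i \<noteq> j \<longrightarrow>
        spec_partials_exist \<Omega> (j # i # js) u \<and> continuous_on \<Omega> (spec_partials (j # i # js) u))"]
    by meson
qed

section \<open>The inclusions\<close>

lemma spec_partials_Cons: "spec_partials (j # js) u = spec_partial j (spec_partials js u)"
  by (simp add: spec_partials_def)

lemma partials_Cons: "partials (j # js) u = partial_deriv j (partials js u)"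
  by (simp add: partials_def)

section \<open>From classical to specular: \<open>Ck_space k\<close> in
  \<open>specular_space k\<close>\<close>

lemma spec_partials_eq_partials:
  fixes \<Omega> :: "(real^'n) set"
  assumes "open \<Omega>" "partials_exist \<Omega> js u"
  shows "spec_partials_exist \<Omega> js u \<and> (\<forall>x\<in>\<Omega>. spec_partials js u x = partials js u x)"
  using assms(2)
proof (induction js)
  case Nil
  then show ?case by (simp add: spec_partials_def partials_def)
next
  case (Cons j js)
  then have IH: "spec_partials_exist \<Omega> js u" "\<And>x. x \<in> \<Omega> \<Longrightarrow> partials js u x = spec_partials js u x"
    by auto
  \<comment> \<open>The induction hypothesis gives equality on \<Omega> only, which
    \<open>partial_cong\<close> turns into equality of the next derivatives.\<close>
  have "has_partial j (spec_partials js u) x"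
    "partial_deriv j (spec_partials js u) x = partial_deriv j (partials js u) x" if "x \<in> \<Omega>" for x
    using partial_cong[OF assms(1) that IH(2), where i = j] Cons.prems that by auto
  with IH(1) show ?case
    by (auto simp: spec_partials_Cons partials_Cons has_spec_partial_of_has_partial)
qed

text \<open>\<open>Ck_space\<close> admits every order of differentiation, so it covers the sorted
  lists as well as the lists \<open>j # i # js\<close>, whose length is at most
  \<open>k\<close>.\<close>

lemma Ck_space_subset_specular_space:
  fixes \<Omega> :: "(real^'n::{finite,linorder}) set"
  assumes "open \<Omega>" "k \<ge> 1"
  shows "Ck_space k \<Omega> \<subseteq> specular_space k \<Omega>"
proof
  fix u assume "u \<in> Ck_space k \<Omega>"
  then have "spec_partials_exist \<Omega> js u \<and> continuous_on \<Omega> (spec_partials js u)"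
    if "length js \<le> k" for js
    using that spec_partials_eq_partials[OF assms(1), of js u]
    by (auto simp: Ck_space_def cong: continuous_on_cong)
  note * = this
  have "continuous_on \<Omega> u" using *[of "[]"] by (simp add: spec_partials_def)
  with * show "u \<in> specular_space k \<Omega>"
    unfolding specular_space_iff[OF assms(2)]
    by (auto intro: proper_function_of_continuous_on[OF assms(1)] simp del: spec_partials_exist.simps)
qed

section \<open>From specular to classical: \<open>specular_space (k + 1)\<close> in
  \<open>Ck_space k\<close>\<close>

context
  fixes \<Omega> :: "(real^'n::{finite,linorder}) set" and k :: nat
    and u :: "real^'n::{finite,linorder} \<Rightarrow> real"
  assumes opn: "open \<Omega>" and u: "u \<in> specular_space (k + 1) \<Omega>"
begin

lemma specular_space_cont: "continuous_on \<Omega> u"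
  using u by (simp add: specular_space_iff)

lemma specular_space_sorted:
  assumes "sorted js" "length js \<le> k + 1"
  shows "spec_partials_exist \<Omega> js u" "proper_function \<Omega> (spec_partials js u)"
  using u assms by (simp_all add: specular_space_iff)

text \<open>At order \<open>k + 1\<close> the mixed condition reads
  \<open>length js + 2 \<le> k + 1\<close>. It supplies differentiability in directions other than
  that of the head \<open>i\<close>.\<close>

lemma specular_space_mixed:
  assumes "sorted js" "length js + 1 \<le> k" "i \<noteq> j"
  shows "\<And>x. x \<in> \<Omega> \<Longrightarrow> has_spec_partial j (spec_partials (i # js) u) x"
    "continuous_on \<Omega> (spec_partial j (spec_partials (i # js) u))"
  using u assms by (simp_all add: specular_space_iff spec_partials_Cons)

lemma continuous_on_spec_partials:
  assumes "sorted js" "length js \<le> k"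
  shows "continuous_on \<Omega> (spec_partials js u)"
proof (cases js)
  case Nil
  then show ?thesis using specular_space_cont by (simp add: spec_partials_def)
next
  case (Cons i qs)
  show ?thesis
  proof (rule continuous_on_of_proper_function)
    show "proper_function \<Omega> (spec_partials js u)"
      using assms by (intro specular_space_sorted) auto
    fix x j assume "x \<in> \<Omega>"
    show "has_spec_partial j (spec_partials js u) x"
    proof (cases "j = i")
      case True
      \<comment> \<open>Repeating the head keeps the list sorted; its length may reach
        \<open>k + 1\<close>, the order of the space.\<close>
      then have "spec_partials_exist \<Omega> (j # js) u"
        using assms Cons by (intro specular_space_sorted) auto
      with \<open>x \<in> \<Omega>\<close> show ?thesis by simp
    next
      case False
      then show ?thesis using specular_space_mixed(1)[of qs i j x] assms Cons \<open>x \<in> \<Omega>\<close> by auto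
    qed
  qed
qed

text \<open>Both \<open>js\<close> and \<open>j # js\<close> have length at most \<open>k\<close>,
  so both derivatives are continuous and the specular derivative is classical.\<close>

lemma sorted_Cons_partial:
  assumes "sorted (j # js)" "length js < k" "x \<in> \<Omega>"
  shows "has_partial j (spec_partials js u) x"
    "partial_deriv j (spec_partials js u) x = spec_partials (j # js) u x"
proof -
  have spec: "has_spec_partial j (spec_partials js u) y" if "y \<in> \<Omega>" for y
    using specular_space_sorted(1)[of "j # js"] assms that by auto
  have cont: "continuous_on \<Omega> (spec_partial j (spec_partials js u))"
    using continuous_on_spec_partials[of "j # js"] assms by (simp add: spec_partials_Cons)
  have "continuous_on \<Omega> (spec_partials js u)"
    using assms by (intro continuous_on_spec_partials) auto
  note * = has_partial_of_has_spec_partial[OF opn this spec cont \<open>x \<in> \<Omega>\<close>]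
  from * show "has_partial j (spec_partials js u) x"
    "partial_deriv j (spec_partials js u) x = spec_partials (j # js) u x"
    by (simp_all add: spec_partials_Cons)
qed

text \<open>Since \<open>j # i # js\<close> may be unsorted, continuity of the outer derivative
  comes from the mixed condition.\<close>

lemma mixed_partial:
  assumes "sorted (i # js)" "length js + 1 < k" "i \<noteq> j" "x \<in> \<Omega>"
  shows "has_partial j (spec_partials (i # js) u) x"
    "partial_deriv j (spec_partials (i # js) u) x = spec_partial j (spec_partials (i # js) u) x"
  using has_partial_of_has_spec_partial[OF opn continuous_on_spec_partials
      specular_space_mixed[OF _ _ assms(3)] assms(4)] assms by auto

text \<open>The induction brings the indices into increasing order: a new index larger than the head
  \<open>i\<close> of the sorted list is commuted past \<open>i\<close>.\<close>

lemma spec_partials_insort: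
  assumes "sorted js" "length js < k" "x \<in> \<Omega>"
  shows "has_partial j (spec_partials js u) x \<and>
    partial_deriv j (spec_partials js u) x = spec_partials (insort j js) u x"
  using assms
proof (induction js arbitrary: x)
  case Nil
  then show ?case using sorted_Cons_partial[of j "[]" x] by simp
next
  case (Cons i qs)
  show ?case
  proof (cases "j \<le> i")
    case True
    with Cons.prems have "sorted (j # i # qs)" by auto
    then show ?thesis using sorted_Cons_partial[of j "i # qs" x] Cons.prems by simp
  next
    case False
    then have "i < j" by (simp only: not_le)
    \<comment> \<open>As \<open>i < j\<close>, insertion leaves \<open>i\<close> in front:
      \<open>i # insort j qs\<close> is the target \<open>insort j (i # qs)\<close>.\<close>
    have qs: "sorted qs" "length qs < k" and iqs: "sorted (i # insort j qs)"
      using Cons.prems False by (auto simp: sorted_insort set_insort_key)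
    define z where "z = spec_partials qs u"
    have zi: "has_partial i z y" "partial_deriv i z y = spec_partials (i # qs) u y"
      if "y \<in> \<Omega>" for y
      using sorted_Cons_partial[of i qs y] Cons.prems that by (auto simp: z_def)
    have zj: "has_partial j z y" "partial_deriv j z y = spec_partials (insort j qs) u y"
      if "y \<in> \<Omega>" for y
      using Cons.IH[OF qs that] by (auto simp: z_def)
    have m: "has_partial j (spec_partials (i # qs) u) y"
      "partial_deriv j (spec_partials (i # qs) u) y = spec_partial j (spec_partials (i # qs) u) y"
      if "y \<in> \<Omega>" for y
      using mixed_partial[of i qs j y] Cons.prems that \<open>i < j\<close> by auto
    have n: "has_partial i (spec_partials (insort j qs) u) y"
      "partial_deriv i (spec_partials (insort j qs) u) y = spec_partials (i # insort j qs) u y"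
      if "y \<in> \<Omega>" for y
      using sorted_Cons_partial[OF iqs _ that] Cons.prems by auto
    have zij: "has_partial j (partial_deriv i z) y"
      "partial_deriv j (partial_deriv i z) y = spec_partial j (spec_partials (i # qs) u) y"
      if "y \<in> \<Omega>" for y
      using partial_cong[OF opn that zi(2)[symmetric] m(1)[OF that]] m(2)[OF that] by auto
    have zji: "has_partial i (partial_deriv j z) y"
      "partial_deriv i (partial_deriv j z) y = spec_partials (i # insort j qs) u y"
      if "y \<in> \<Omega>" for y
      using partial_cong[OF opn that zj(2)[symmetric] n(1)[OF that]] n(2)[OF that] by auto
    \<comment> \<open>The two mixed derivatives are continuous for different reasons:
      \<open>j\<close> after \<open>i\<close> by the mixed condition over \<open>qs\<close>,
      \<open>i\<close> after \<open>j\<close> because it belongs to a sorted list of length at most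
      \<open>k\<close>.\<close>
    have "continuous_on \<Omega> (spec_partial j (spec_partials (i # qs) u))"
      using specular_space_mixed(2)[of qs i j] Cons.prems \<open>i < j\<close> by auto
    then have cij: "continuous_on \<Omega> (partial_deriv j (partial_deriv i z))"
      by (simp add: zij(2) cong: continuous_on_cong)
    have "continuous_on \<Omega> (spec_partials (i # insort j qs) u)"
      using iqs Cons.prems by (intro continuous_on_spec_partials) auto
    then have cji: "continuous_on \<Omega> (partial_deriv i (partial_deriv j z))"
      by (simp add: zji(2) cong: continuous_on_cong)
    have "partial_deriv j (partial_deriv i z) x = partial_deriv i (partial_deriv j z) x"
      by (rule mixed_partials_commute[OF opn Cons.prems(3) zi(1) zj(1) zij(1) zji(1) cij cji])
    with m[OF Cons.prems(3)] zij(2)[OF Cons.prems(3)] zji(2)[OF Cons.prems(3)] False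
    show ?thesis by simp
  qed
qed

text \<open>As \<open>sort (j # js)\<close> is \<open>insort j (sort js)\<close>, each further
  derivative is absorbed by \<open>spec_partials_insort\<close>.\<close>

lemma partials_eq_spec_partials_sort:
  assumes "length js \<le> k"
  shows "partials_exist \<Omega> js u \<and> (\<forall>x\<in>\<Omega>. partials js u x = spec_partials (sort js) u x)"
  using assms
proof (induction js)
  case Nil
  then show ?case by (simp add: spec_partials_def partials_def)
next
  case (Cons j js)
  then have IH: "partials_exist \<Omega> js u" "\<And>x. x \<in> \<Omega> \<Longrightarrow> spec_partials (sort js) u x = partials js u x"
    by auto
  have "has_partial j (partials js u) x"
    "partial_deriv j (partials js u) x = spec_partials (insort j (sort js)) u x" if "x \<in> \<Omega>" for x
    using spec_partials_insort[of "sort js" x j] Cons.prems that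
      partial_cong[OF opn that IH(2), where i = j] by auto
  with IH(1) show ?case by (simp add: partials_Cons)
qed

lemma specular_space_Suc_imp_Ck_space: "u \<in> Ck_space k \<Omega>"
  using partials_eq_spec_partials_sort continuous_on_spec_partials[of "sort js" for js]
  by (auto simp: Ck_space_def cong: continuous_on_cong)

end

theorem theorem3p5:
  fixes \<Omega> :: "(real^'n::{finite,linorder}) set" and k :: nat
  assumes "open \<Omega>" and "k \<ge> 1"
  shows "specular_space (k + 1) \<Omega> \<subseteq> Ck_space k \<Omega> \<and> Ck_space k \<Omega> \<subseteq> specular_space k \<Omega>"
  using specular_space_Suc_imp_Ck_space[OF assms(1)] Ck_space_subset_specular_space[OF assms]
  by blast

end
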